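(* The following hold for all integers $n\geq 0$: (1) $p(3n+1,2)+p(3n+2,2)\equiv 0\pmod{3}$; (2) $p(10n+6,4)+p(10n+7,4)+p(10n+8,4)\equiv 0\pmod{5}$; (3) $p(10n+2,4)+p(10n+3,4)+p(10n+4,4)\equiv 0\pmod{5}$.
   Context: For a positive integer $m$ and integer $n\ge 0$, $p(n,m)$ denotes the number of partitions of $n$ all of whose parts are at most $m$, i.e. $\sum_{n=0}^{\infty}p(n,m)q^{n}=\frac{1}{(1-q)(1-q^2)\cdots (1-q^{m})}$. *)

theory Defs
  imports "HOL-Library.Multiset" "HOL-Number_Theory.Number_Theory"
begin

(* A partition of n is a finite multiset of positive integers with sum n. *)
definition partitions_bounded :: "nat \<Rightarrow> nat \<Rightarrow> nat multiset set" where
  "partitions_bounded n m = {M. (\<forall>k \<in># M. 1 \<le> k \<and> k \<le> m) \<and> sum_mset M = n}"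

definition part_count :: "nat \<Rightarrow> nat \<Rightarrow> nat" where
  "part_count n m = card (partitions_bounded n m)"

(* Finiteness ensures that card is the genuine number of partitions. *)
lemma finite_partitions_bounded: "finite (partitions_bounded n m)"
proof -
  have size_le: "size M \<le> sum_mset M" if "\<forall>k \<in># M. 1 \<le> k" for M :: "nat multiset"
    using that by (induction M) auto
  have "partitions_bounded n m \<subseteq> mset ` {xs. set xs \<subseteq> {1..m} \<and> length xs \<le> n}"
  proof
    fix M assume M: "M \<in> partitions_bounded n m"
    obtain xs where xs: "mset xs = M"
      using ex_mset by blast
    have "set xs \<subseteq> {1..m}"
      using M xs by (auto simp: partitions_bounded_def)
    moreover have "length xs \<le> n"
      using M xs size_le[of M] by (auto simp: partitions_bounded_def)
    ultimately show "M \<in> mset ` {xs. set xs \<subseteq> {1..m} \<and> length xs \<le> n}"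
      using xs by blast
  qed
  then show ?thesis
    by (rule finite_subset) (intro finite_imageI finite_lists_length_le finite_atLeastAtMost)
qed

end

theory Submission
  imports Defs
begin

text \<open>Write \<open>U k\<close> and \<open>T k\<close> for the sums of three consecutive values, starting at \<open>k\<close>, of
  \<open>p(_,3)\<close> and \<open>p(_,4)\<close>. Summing three consecutive terms replaces the factor
  \<open>1/(1 - q\<^sup>3)\<close> of the generating function by \<open>1/(1 - q)\<close>, which gives
  \<open>U (2a) = (a + 2)\<^sup>2\<close>. Hence \<open>T (2a + 4) = T (2a) + (a + 4)\<^sup>2\<close>, and five such steps add the
  squares of a complete residue system modulo 5, whose sum is divisible by 5. So \<open>T\<close> modulo 5 is
  20-periodic on even arguments, and only four initial values remain.\<close>

text \<open>Split by whether \<open>Suc m\<close> occurs as a part. If it does, deleting one copy is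
  a bijection onto the partitions of \<open>n\<close> with parts at most
  \<open>Suc m\<close>.\<close>

lemma part_count_Suc_add:
  "part_count (n + Suc m) (Suc m) = part_count (n + Suc m) m + part_count n (Suc m)"
proof -
  let ?A = "partitions_bounded (n + Suc m) m"
  let ?B = "add_mset (Suc m) ` partitions_bounded n (Suc m)"
  have "partitions_bounded (n + Suc m) (Suc m) = ?A \<union> ?B"
  proof (intro equalityI subsetI)
    fix M assume M: "M \<in> partitions_bounded (n + Suc m) (Suc m)"
    show "M \<in> ?A \<union> ?B"
    proof (cases "Suc m \<in># M")
      case True
      then obtain N where "M = add_mset (Suc m) N"
        by (blast dest: multi_member_split)
      with M show ?thesis
        by (auto simp: partitions_bounded_def)
    next
      case False
      then have "k \<le> m" if "k \<in># M" for k
        using M that by (force simp: partitions_bounded_def le_Suc_eq)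
      with M show ?thesis
        by (auto simp: partitions_bounded_def)
    qed
  qed (auto simp: partitions_bounded_def le_SucI)
  moreover have "?A \<inter> ?B = {}"
    by (auto simp: partitions_bounded_def)
  moreover have "card ?B = part_count n (Suc m)"
    unfolding part_count_def by (rule card_image) (simp add: inj_on_def)
  ultimately show ?thesis
    by (simp add: part_count_def card_Un_disjoint finite_partitions_bounded)
qed

lemma part_count_Suc_less:
  assumes "n < Suc m"
  shows "part_count n (Suc m) = part_count n m"
proof -
  have "k \<le> n" if "k \<in># M" "sum_mset M = n" for k and M :: "nat multiset"
    using that by (auto dest!: multi_member_split)
  then have "partitions_bounded n (Suc m) = partitions_bounded n m"
    using assms by (fastforce simp: partitions_bounded_def)
  then show ?thesis
    by (simp add: part_count_def)
qed

lemma part_count_0: "part_count n 0 = (if n = 0 then 1 else 0)"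
proof -
  have "(\<forall>k \<in># M. 1 \<le> k \<and> k \<le> 0) \<longleftrightarrow> M = {#}" for M :: "nat multiset"
    by (cases M) auto
  then have "partitions_bounded n 0 = (if n = 0 then {{#}} else {})"
    by (auto simp: partitions_bounded_def)
  then show ?thesis
    by (simp add: part_count_def)
qed

lemma part_count_1: "part_count n 1 = 1"
proof (induction n)
  case 0
  then show ?case
    using part_count_Suc_less[of 0 0] by (simp add: part_count_0)
next
  case (Suc n)
  then show ?case
    using part_count_Suc_add[of n 0] by (simp add: part_count_0)
qed

lemma part_count_2: "part_count n 2 = n div 2 + 1"
proof (induction n rule: induct_nat_012)
  case 0
  then show ?case
    using part_count_Suc_less[of 0 1] part_count_1[of 0] by (simp add: numeral_2_eq_2)
next
  case 1
  then show ?case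
    using part_count_Suc_less[of 1 1] part_count_1[of 1] by (simp add: numeral_2_eq_2)
next
  case (ge2 n)
  then show ?case
    using part_count_Suc_add[of n 1] part_count_1[of "n + 2"]
    by (simp flip: numeral_2_eq_2)
qed

lemma part_count_3_add: "part_count (n + 3) 3 = part_count n 3 + (n + 3) div 2 + 1"
  using part_count_Suc_add[of n 2] by (simp add: part_count_2)

lemma part_count_3_less: "n < 3 \<Longrightarrow> part_count n 3 = n div 2 + 1"
  using part_count_Suc_less[of n 2] by (simp add: part_count_2)

lemma part_count_4_add: "part_count (n + 4) 4 = part_count (n + 4) 3 + part_count n 4"
  using part_count_Suc_add[of n 3] by simp

lemma part_count_4_less: "n < 4 \<Longrightarrow> part_count n 4 = part_count n 3"
  using part_count_Suc_less[of n 3] by simp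

definition triple_sum :: "nat \<Rightarrow> nat \<Rightarrow> nat" where
  "triple_sum m k = part_count k m + part_count (k + 1) m + part_count (k + 2) m"

lemma triple_sum_3_even: "triple_sum 3 (2 * a) = (a + 2)\<^sup>2"
proof (induction a)
  case 0
  then show ?case
    by (simp add: triple_sum_def part_count_3_less power2_eq_square)
next
  case (Suc a)
  \<comment> \<open>The last two terms have the form \<open>_ + 3\<close>, so the recurrence returns
    them to \<open>2 * a\<close> and \<open>2 * a + 1\<close>, adding \<open>a + 2\<close> and
    \<open>a + 3\<close>. Their total \<open>2 * a + 5\<close> is the difference of consecutive
    squares.\<close>
  have "triple_sum 3 (2 * Suc a) =
      part_count (2 * a + 2) 3 + part_count (2 * a + 3) 3 + part_count (2 * a + 1 + 3) 3"
    by (simp add: triple_sum_def eval_nat_numeral)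
  also have "\<dots> = triple_sum 3 (2 * a) + 2 * a + 5"
    unfolding part_count_3_add triple_sum_def by presburger
  finally have "triple_sum 3 (2 * Suc a) = triple_sum 3 (2 * a) + 2 * a + 5" .
  with Suc show ?case
    by (simp add: power2_eq_square algebra_simps)
qed

lemma triple_sum_4_step: "triple_sum 4 (2 * a + 4) = triple_sum 4 (2 * a) + (a + 4)\<^sup>2"
proof -
  have "triple_sum 4 (2 * a + 4) = triple_sum 4 (2 * a) + triple_sum 3 (2 * a + 4)"
    using part_count_4_add[of "2 * a"] part_count_4_add[of "2 * a + 1"]
      part_count_4_add[of "2 * a + 2"]
    by (simp add: triple_sum_def eval_nat_numeral)
  also have "triple_sum 3 (2 * a + 4) = (a + 4)\<^sup>2"
    using triple_sum_3_even[of "a + 2"] by (simp del: add_2_eq_Suc')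
  finally show ?thesis .
qed

text \<open>The five steps add the squares of \<open>a + 4\<close>, \<open>a + 6\<close>,
  \<open>a + 8\<close>, \<open>a + 10\<close> and \<open>a + 12\<close>.\<close>

lemma triple_sum_4_add_20:
  "triple_sum 4 (2 * a + 20) = triple_sum 4 (2 * a) + 5 * (a\<^sup>2 + 16 * a + 72)"
  using triple_sum_4_step[of a] triple_sum_4_step[of "a + 2"] triple_sum_4_step[of "a + 4"]
    triple_sum_4_step[of "a + 6"] triple_sum_4_step[of "a + 8"]
  by (simp add: power2_eq_square algebra_simps del: add_2_eq_Suc add_2_eq_Suc')

text \<open>A period of 20 splits each progression \<open>10 * n + 2\<close> and
  \<open>10 * n + 6\<close> by the parity of \<open>n\<close>, so each needs two starting
  values.\<close>

lemma triple_sum_4_initial: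
  "triple_sum 4 2 = 10" "triple_sum 4 6 = 35" "triple_sum 4 12 = 120" "triple_sum 4 16 = 220"
proof -
  have p3: "part_count 3 3 = 3"
    using part_count_3_add[of 0] by (simp add: part_count_3_less)
  have p4: "part_count 4 4 = 5"
    using part_count_3_add[of 1] part_count_4_add[of 0]
    by (simp add: part_count_3_less part_count_4_less)
  show T2: "triple_sum 4 2 = 10"
    by (simp add: triple_sum_def part_count_4_less part_count_3_less p3 p4)
  show "triple_sum 4 6 = 35"
    using triple_sum_4_step[of 1] T2 by simp
  \<comment> \<open>Only an anchor: steps of 4 lead from 0 through 4 and 8 to 12.\<close>
  have "triple_sum 4 0 = 4"
    by (simp add: triple_sum_def part_count_4_less part_count_3_less)
  then show T12: "triple_sum 4 12 = 120"
    using triple_sum_4_step[of 0] triple_sum_4_step[of 2] triple_sum_4_step[of 4] by simp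
  show "triple_sum 4 16 = 220"
    using triple_sum_4_step[of 6] T12 by simp
qed

text \<open>Raising \<open>n\<close> by 2 shifts the argument by 20, hence two base cases and a
  two-step induction.\<close>

lemma triple_sum_4_dvd:
  assumes "5 dvd triple_sum 4 (2 * a)" and "5 dvd triple_sum 4 (2 * a + 10)"
  shows "5 dvd triple_sum 4 (10 * n + 2 * a)"
proof (induction n rule: induct_nat_012)
  case (ge2 n)
  then show ?case
    using triple_sum_4_add_20[of "5 * n + a"] by (simp add: add_ac)
qed (use assms in \<open>simp_all add: add_ac\<close>)

theorem theorem3p6:
  fixes n :: nat
  shows "[part_count (3 * n + 1) 2 + part_count (3 * n + 2) 2 = 0] (mod 3) \<and>
    [part_count (10 * n + 6) 4 + part_count (10 * n + 7) 4 + part_count (10 * n + 8) 4 = 0] (mod 5) \<and>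
    [part_count (10 * n + 2) 4 + part_count (10 * n + 3) 4 + part_count (10 * n + 4) 4 = 0] (mod 5)"
proof (intro conjI)
  \<comment> \<open>For consecutive \<open>k\<close> and \<open>k + 1\<close> the halves rounded
    down add up to \<open>k\<close>; here \<open>k = 3 * n + 1\<close>.\<close>
  have "part_count (3 * n + 1) 2 + part_count (3 * n + 2) 2 = 3 * (n + 1)"
    unfolding part_count_2 by presburger
  then show "[part_count (3 * n + 1) 2 + part_count (3 * n + 2) 2 = 0] (mod 3)"
    by (simp only: cong_0_iff dvd_triv_left)
  show "[part_count (10 * n + 6) 4 + part_count (10 * n + 7) 4 + part_count (10 * n + 8) 4 = 0] (mod 5)"
    \<comment> \<open>The base values are at 6 and 16; the instance with 1 below uses 2 and
      12.\<close>
    using triple_sum_4_dvd[of 3 n]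
    by (simp add: triple_sum_4_initial cong_0_iff) (simp add: triple_sum_def add_ac)
  show "[part_count (10 * n + 2) 4 + part_count (10 * n + 3) 4 + part_count (10 * n + 4) 4 = 0] (mod 5)"
    using triple_sum_4_dvd[of 1 n]
    by (simp add: triple_sum_4_initial cong_0_iff) (simp add: triple_sum_def eval_nat_numeral)
qed

end
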